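(* Let $0 < \theta \leq 1$ and $0 < \lambda \leq 1$. Let $m \to \infty$ and $k \to \infty$ along integers $0 < k \leq m$ with $k/m \to \lambda$, and let $K(s) = \ln \mathbb{E}(e^{sT_k})$ be the cumulant generating function of $T_k \sim \text{NegOcc}(m,k,\theta)$. Then for each fixed real $s < -\ln(1-(1-\lambda)\theta)$, $$K(s) \sim m\left[\begin{array}{l} \lambda\ln(\theta) - (1-\lambda)\ln|1-\lambda| \\[4pt] -\dfrac{1-(1-\theta)e^s}{\theta e^s}\cdot\ln|1-(1-\theta)e^s| \\[8pt] +\dfrac{1-(1-\theta)e^s-\lambda\theta e^s}{\theta e^s}\cdot\ln|1-(1-\theta)e^s-\lambda\theta e^s| \end{array}\right]$$ (the bracket being the sum of the displayed terms). In the classical case $\theta = 1$ this reads $$K(s) \sim m\left[-(1-\lambda)\ln|1-\lambda| + \frac{1-\lambda e^s}{e^s}\cdot\ln|1-\lambda e^s|\right].$$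
   Context: Falling factorials: $(m)_k = \prod_{i=0}^{k-1}(m-i)$. The noncentral Stirling numbers of the second kind are, for integers $n, k \geq 0$ and real $\phi$, $$S(n,k,\phi) = \frac{1}{k!}\sum_{i=0}^{k} \binom{k}{i} (-1)^{k-i} (i+\phi)^n, \qquad 0^0 = 1.$$ The negative occupancy distribution $\text{NegOcc}(m,k,\theta)$ is the distribution on the integers $t \geq 0$ with probability mass function $$\text{NegOcc}(t|m,k,\theta) = \frac{\theta^{k+t}}{m^{k+t}} \cdot (m)_k \cdot S\left(k+t-1, k-1, m\cdot\frac{1-\theta}{\theta}\right).$$ The cumulant generating function $K(s)$ is finite for $s < \ln\left(\frac{m}{m-(m-k+1)\theta}\right)$; a fixed $s < -\ln(1-(1-\lambda)\theta)$ lies in this domain for all sufficiently large $m,k$ in the limit. The notation $a \sim b$ means $a = b\,(1+o(1))$ in the stated limit. Convention: $0\cdot\ln 0 = 0$. *)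

theory Defs
  imports "HOL-Probability.Probability" "HOL-Library.Landau_Symbols"
begin

definition falling_factorial :: "real \<Rightarrow> nat \<Rightarrow> real" where
  "falling_factorial x k = (\<Prod>i<k. x - real i)"

definition nc_stirling2 :: "nat \<Rightarrow> nat \<Rightarrow> real \<Rightarrow> real" where
  "nc_stirling2 n k \<phi> =
     1 / fact k * (\<Sum>i\<le>k. real (k choose i) * (-1) ^ (k - i) * (real i + \<phi>) ^ n)"

definition negocc_mass :: "nat \<Rightarrow> nat \<Rightarrow> real \<Rightarrow> nat \<Rightarrow> real" where
  "negocc_mass m k \<theta> t =
     \<theta> ^ (k + t) / real m ^ (k + t) * falling_factorial (real m) k
       * nc_stirling2 (k + t - 1) (k - 1) (real m * ((1 - \<theta>) / \<theta>))"

(* Only meaningful where the mass function is nonnegative and sums to 1, which holds for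
   0 < k <= m and 0 < \<theta> <= 1: see pmf_negocc below. *)
definition negocc_pmf :: "nat \<Rightarrow> nat \<Rightarrow> real \<Rightarrow> nat pmf" where
  "negocc_pmf m k \<theta> = embed_pmf (negocc_mass m k \<theta>)"

(* Outside the domain of finiteness the Bochner integral is 0, so this function takes the
   value ln 0 = 0 there instead of infinity. *)
definition negocc_cgf :: "nat \<Rightarrow> nat \<Rightarrow> real \<Rightarrow> real \<Rightarrow> real" where
  "negocc_cgf m k \<theta> s = ln (measure_pmf.expectation (negocc_pmf m k \<theta>) (\<lambda>t. exp (s * real t)))"

lemma nc_stirling2_0: "nc_stirling2 n 0 \<phi> = \<phi> ^ n"
  by (simp add: nc_stirling2_def)

lemma nc_stirling2_0_Suc: "nc_stirling2 0 (Suc k) \<phi> = 0"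
proof -
  have "(\<Sum>i\<le>Suc k. real (Suc k choose i) * (-1) ^ (Suc k - i))
      = (\<Sum>i\<le>Suc k. (-1) ^ Suc k * ((-1) ^ i * real (Suc k choose i)))"
  proof (rule sum.cong)
    fix i assume "i \<in> {..Suc k}"
    then have "(-1::real) ^ Suc k = (-1) ^ (Suc k - i) * (-1) ^ i"
      by (simp del: power_Suc flip: power_add)
    then have "(-1::real) ^ (Suc k - i) = (-1) ^ Suc k * (-1) ^ i"
      by (simp only: mult.assoc minus_one_mult_self mult_1_right)
    then show "real (Suc k choose i) * (-1) ^ (Suc k - i)
        = (-1) ^ Suc k * ((-1) ^ i * real (Suc k choose i))"
      by (simp only: ac_simps)
  qed simp
  also have "\<dots> = (-1) ^ Suc k * (\<Sum>i\<le>Suc k. (-1) ^ i * real (Suc k choose i))"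
    by (simp only: sum_distrib_left)
  also have "\<dots> = 0"
    using choose_alternating_sum[of "Suc k", where 'a = real] by simp
  finally show ?thesis
    by (simp add: nc_stirling2_def)
qed

lemma nc_stirling2_Suc_Suc:
  "nc_stirling2 (Suc n) (Suc k) \<phi>
     = nc_stirling2 n k \<phi> + (real (Suc k) + \<phi>) * nc_stirling2 n (Suc k) \<phi>"
proof -
  define c where "c = (\<lambda>i. real (Suc k choose i) * (-1) ^ (Suc k - i) * (real i + \<phi>) ^ n)"
  define d where "d = (\<lambda>i. real (k choose i) * (-1) ^ (k - i) * (real i + \<phi>) ^ n)"
  have step: "real (Suc k choose i) * (-1) ^ (Suc k - i) * (real i + \<phi>) ^ Suc n
      = (real (Suc k) + \<phi>) * c i + real (Suc k) * (if i \<le> k then d i else 0)"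
    if "i \<le> Suc k" for i
  proof (cases "i \<le> k")
    case True
    have "(Suc k - i) * (Suc k choose i) = Suc k * (k choose i)"
      using binomial_absorb_comp[of "Suc k" i] by simp
    then have "real (Suc k - i) * real (Suc k choose i) = real (Suc k) * real (k choose i)"
      by (metis of_nat_mult)
    then have e: "(real (Suc k) - real i) * real (Suc k choose i) = real (Suc k) * real (k choose i)"
      using that by (simp add: of_nat_diff)
    have p: "(-1::real) ^ (Suc k - i) = - ((-1) ^ (k - i))"
      using True by (simp add: Suc_diff_le)
    have "real (Suc k) * d i = ((real (Suc k) - real i) * real (Suc k choose i))
        * (-1) ^ (k - i) * (real i + \<phi>) ^ n"
      by (simp only: e d_def mult.assoc)
    also have "\<dots> = - (real (Suc k) - real i) * c i"
      unfolding c_def p by (simp only: mult.assoc mult_minus_left mult_minus_right minus_minus)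
    finally show ?thesis
      using True by (simp add: c_def algebra_simps del: of_nat_Suc)
  next
    case False
    with that have "i = Suc k" by simp
    then show ?thesis by (simp add: c_def algebra_simps)
  qed
  have "(\<Sum>i\<le>Suc k. real (Suc k choose i) * (-1) ^ (Suc k - i) * (real i + \<phi>) ^ Suc n)
      = (\<Sum>i\<le>Suc k. (real (Suc k) + \<phi>) * c i + real (Suc k) * (if i \<le> k then d i else 0))"
    using step by (intro sum.cong) auto
  also have "\<dots> = (real (Suc k) + \<phi>) * (\<Sum>i\<le>Suc k. c i) + real (Suc k) * (\<Sum>i\<le>k. d i)"
    by (simp add: sum.distrib sum_distrib_left distrib_left)
  finally have num: "(\<Sum>i\<le>Suc k. real (Suc k choose i) * (-1) ^ (Suc k - i) * (real i + \<phi>) ^ Suc n)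
      = (real (Suc k) + \<phi>) * (\<Sum>i\<le>Suc k. c i) + real (Suc k) * (\<Sum>i\<le>k. d i)" .
  have "1 / fact (Suc k) * (real (Suc k) * D) = 1 / fact k * D" for D :: real
    by (simp add: fact_Suc del: of_nat_Suc)
  then show ?thesis
    unfolding nc_stirling2_def num c_def[symmetric] d_def[symmetric]
    by (simp only: distrib_left add.commute mult.left_commute)
qed

lemma nc_stirling2_eq_0: "n < k \<Longrightarrow> nc_stirling2 n k \<phi> = 0"
proof (induction n arbitrary: k)
  case 0
  then show ?case by (cases k) (auto simp: nc_stirling2_0_Suc)
next
  case (Suc n)
  then show ?case by (cases k) (auto simp: nc_stirling2_Suc_Suc)
qed

lemma nc_stirling2_nonneg: "\<phi> \<ge> 0 \<Longrightarrow> nc_stirling2 n k \<phi> \<ge> 0"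
proof (induction n arbitrary: k)
  case 0
  then show ?case by (cases k) (auto simp: nc_stirling2_0_Suc nc_stirling2_0)
next
  case (Suc n)
  then show ?case by (cases k) (auto simp: nc_stirling2_Suc_Suc nc_stirling2_0)
qed

lemma falling_factorial_nonneg: "k \<le> m \<Longrightarrow> falling_factorial (real m) k \<ge> 0"
  unfolding falling_factorial_def by (intro prod_nonneg) auto

lemma negocc_mass_nonneg:
  assumes "k \<le> m" "0 < \<theta>" "\<theta> \<le> 1"
  shows "negocc_mass m k \<theta> t \<ge> 0"
  unfolding negocc_mass_def using assms
  by (intro mult_nonneg_nonneg falling_factorial_nonneg nc_stirling2_nonneg divide_nonneg_nonneg) auto

lemma negocc_mass_1:
  assumes "0 < m" "0 < \<theta>"
  shows "negocc_mass m 1 \<theta> t = \<theta> * (1 - \<theta>) ^ t"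
  using assms by (simp add: negocc_mass_def nc_stirling2_0 falling_factorial_def
      power_mult_distrib power_divide)

lemma negocc_mass_Suc_0:
  assumes "0 < k" "k < m" "0 < \<theta>"
  shows "negocc_mass m (Suc k) \<theta> 0 = \<theta> * (real m - real k) / real m * negocc_mass m k \<theta> 0"
proof -
  obtain j where k: "k = Suc j" using assms(1) by (cases k) auto
  show ?thesis
    using assms by (simp add: negocc_mass_def k nc_stirling2_Suc_Suc nc_stirling2_eq_0
        falling_factorial_def field_simps)
qed

lemma negocc_mass_Suc_Suc:
  assumes "0 < k" "k < m" "0 < \<theta>"
  defines "a \<equiv> \<theta> * (real m - real k) / real m"
  shows "negocc_mass m (Suc k) \<theta> (Suc t)
           = a * negocc_mass m k \<theta> (Suc t) + (1 - a) * negocc_mass m (Suc k) \<theta> t"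
proof -
  obtain j where k: "k = Suc j" using assms(1) by (cases k) auto
  define \<phi> where "\<phi> = real m * ((1 - \<theta>) / \<theta>)"
  define x where "x = \<theta> / real m"
  define F where "F = falling_factorial (real m) k"
  have F: "falling_factorial (real m) (Suc k) = F * (real m - real k)"
    by (simp add: F_def falling_factorial_def)
  have a1: "a = x * (real m - real k)"
    by (simp add: a_def x_def)
  have a2: "1 - a = x * (real k + \<phi>)"
    using assms(2,3) by (simp add: a_def x_def \<phi>_def field_simps)
  have mass: "negocc_mass m i \<theta> u
      = x ^ (i + u) * falling_factorial (real m) i * nc_stirling2 (i + u - 1) (i - 1) \<phi>" for i u
    by (simp add: negocc_mass_def x_def \<phi>_def power_divide)
  have S: "nc_stirling2 (Suc (k + t)) k \<phi>
      = nc_stirling2 (k + t) j \<phi> + (real k + \<phi>) * nc_stirling2 (k + t) k \<phi>"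
    using nc_stirling2_Suc_Suc[of "k + t" j \<phi>] by (simp add: k)
  have L: "negocc_mass m (Suc k) \<theta> (Suc t)
      = x ^ (k + t + 2) * (F * (real m - real k)) * nc_stirling2 (Suc (k + t)) k \<phi>"
    by (simp add: mass F)
  have R1: "negocc_mass m k \<theta> (Suc t) = x ^ (k + t + 1) * F * nc_stirling2 (k + t) j \<phi>"
    by (simp add: mass F_def k)
  have R2: "negocc_mass m (Suc k) \<theta> t
      = x ^ (k + t + 1) * (F * (real m - real k)) * nc_stirling2 (k + t) k \<phi>"
    by (simp add: mass F)
  show ?thesis
    unfolding L R1 R2 S a2 unfolding a1 by (simp add: algebra_simps)
qed

lemma negocc_mass_sums:
  assumes "0 < k" "k \<le> m" "0 < \<theta>" "\<theta> \<le> 1"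
  shows "negocc_mass m k \<theta> sums 1"
  using assms(1,2)
proof (induction k rule: nat_induct_non_zero)
  case 1
  have "(\<lambda>t. \<theta> * (1 - \<theta>) ^ t) sums (\<theta> * (1 / (1 - (1 - \<theta>))))"
    using assms by (intro sums_mult geometric_sums) auto
  then have "(\<lambda>t. \<theta> * (1 - \<theta>) ^ t) sums 1"
    using assms by simp
  moreover have "negocc_mass m 1 \<theta> = (\<lambda>t. \<theta> * (1 - \<theta>) ^ t)"
    using negocc_mass_1 1 assms by auto
  ultimately show ?case by simp
next
  case (Suc k)
  let ?p = "negocc_mass m k \<theta>" and ?q = "negocc_mass m (Suc k) \<theta>"
  define a where "a = \<theta> * (real m - real k) / real m"
  have km: "0 < k" "k < m" using Suc by auto
  have p: "?p sums 1" using Suc by simp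
  have a0: "0 < a" using km assms by (simp add: a_def)
  have "\<theta> * (real m - real k) \<le> 1 * real m"
    using km assms by (intro mult_mono) auto
  then have a1: "a \<le> 1" using km by (simp add: a_def field_simps)
  have q0: "?q 0 = a * ?p 0"
    using negocc_mass_Suc_0[OF km assms(3)] by (simp add: a_def)
  have qS: "?q (Suc t) = a * ?p (Suc t) + (1 - a) * ?q t" for t
    using negocc_mass_Suc_Suc[OF km assms(3)] by (simp add: a_def)
  have pnn: "?p t \<ge> 0" and qnn: "?q t \<ge> 0" for t
    using negocc_mass_nonneg assms Suc.prems by auto
  have ple: "(\<Sum>t<n. ?p t) \<le> 1" for n
    using sum_le_suminf[of ?p "{..<n}"] p pnn by (auto simp: sums_iff)
  have rec: "(\<Sum>t<Suc n. ?q t) = a * (\<Sum>t<Suc n. ?p t) + (1 - a) * (\<Sum>t<n. ?q t)" for n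
    by (simp only: sum.lessThan_Suc_shift q0 qS sum.distrib sum_distrib_left distrib_left
        add.assoc)
  have qle: "(\<Sum>t<n. ?q t) \<le> 1" for n
  proof (induction n)
    case (Suc n)
    have "a * (\<Sum>t<Suc n. ?p t) + (1 - a) * (\<Sum>t<n. ?q t) \<le> a * 1 + (1 - a) * 1"
      using a0 a1 ple[of "Suc n"] Suc by (intro add_mono mult_left_mono) auto
    then show ?case unfolding rec by simp
  qed simp
  have sq: "summable ?q"
    using qnn qle by (intro summableI_nonneg_bounded[where x = 1]) auto
  have "(\<lambda>n. \<Sum>t<Suc n. ?q t) \<longlonglongrightarrow> a * 1 + (1 - a) * suminf ?q"
    unfolding rec using p summable_LIMSEQ[OF sq]
    by (intro tendsto_intros LIMSEQ_Suc) (auto simp: sums_def)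
  moreover have "(\<lambda>n. \<Sum>t<Suc n. ?q t) \<longlonglongrightarrow> suminf ?q"
    using LIMSEQ_Suc[OF summable_LIMSEQ[OF sq]] .
  ultimately have "suminf ?q = a * 1 + (1 - a) * suminf ?q"
    using LIMSEQ_unique by blast
  then have "suminf ?q = 1" using a0 by (simp add: algebra_simps)
  with sq show ?case by (simp add: sums_iff)
qed

lemma pmf_negocc:
  assumes "0 < k" "k \<le> m" "0 < \<theta>" "\<theta> \<le> 1"
  shows "pmf (negocc_pmf m k \<theta>) t = negocc_mass m k \<theta> t"
  unfolding negocc_pmf_def
proof (rule pmf_embed_pmf)
  show nn: "0 \<le> negocc_mass m k \<theta> t" for t
    using negocc_mass_nonneg assms by auto
  have "(\<integral>\<^sup>+t. ennreal (negocc_mass m k \<theta> t) \<partial>count_space UNIV)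
      = (\<Sum>t. ennreal (negocc_mass m k \<theta> t))"
    by (rule nn_integral_count_space_nat)
  also have "\<dots> = ennreal 1"
    using nn negocc_mass_sums[OF assms] by (intro suminf_ennreal_eq)
  finally show "(\<integral>\<^sup>+t. ennreal (negocc_mass m k \<theta> t) \<partial>count_space UNIV) = 1" by simp
qed

end

theory Submission
  imports Defs "HOL-Real_Asymp.Real_Asymp"
begin

text \<open>
  \<open>T\<^sub>k\<close> is a sum of independent geometric variables with success probabilities
  \<open>p\<^sub>i = \<theta> (1 - i/m)\<close>, \<open>i < k\<close>. Hence \<open>K(s) = (\<Sum>i<k. ln (p\<^sub>i / (1 - (1 - p\<^sub>i) e\<^sup>s)))\<close>, which is
  \<open>m\<close> times a Riemann sum of an explicitly integrable function over \<open>[0, \<lambda>]\<close>. Splitting the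
  logarithm gives two antimonotone integrands, so the Riemann sums converge even when \<open>\<lambda> = 1\<close>, where
  \<open>ln (1 - x)\<close> is singular at the end point. For \<open>s \<noteq> 0\<close> the integrand has no zero in \<open>(0, \<lambda>)\<close>, so the
  limit is nonzero and convergence of \<open>K(s)/m\<close> amounts to asymptotic equivalence; for \<open>s = 0\<close> both
  sides vanish identically.
\<close>

section \<open>Generating function of the distribution\<close>

text \<open>Unrolling the recurrence shows that \<open>q\<close> is \<open>a\<close> times the
  convolution of \<open>p\<close> with the geometric sequence of ratio \<open>c\<close>, so Mertens'
  theorem on Cauchy products gives the sum. Nonnegativity of \<open>p\<close> and the bounds on
  \<open>c\<close> supply absolute convergence.\<close>

lemma sums_linear_recurrence:
  fixes p q :: "nat \<Rightarrow> real"
  assumes "q 0 = a * p 0" "\<And>t. q (Suc t) = a * p (Suc t) + c * q t"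
    and "p sums P" "\<And>t. p t \<ge> 0" "0 \<le> c" "c < 1"
  shows "q sums (a / (1 - c) * P)"
proof -
  have q: "q t = a * (\<Sum>i\<le>t. p i * c ^ (t - i))" for t
  proof (induction t)
    case (Suc t)
    have "(\<Sum>i\<le>t. p i * c ^ (Suc t - i)) = c * (\<Sum>i\<le>t. p i * c ^ (t - i))"
      unfolding sum_distrib_left by (intro sum.cong) (auto simp: Suc_diff_le)
    then show ?case by (simp add: assms(2) Suc algebra_simps)
  qed (simp add: assms(1))
  have "(\<lambda>t. \<Sum>i\<le>t. p i * c ^ (t - i)) sums ((\<Sum>t. p t) * (\<Sum>t. c ^ t))"
    using assms by (intro Cauchy_product_sums) (auto simp: sums_iff)
  then have "(\<lambda>t. a * (\<Sum>i\<le>t. p i * c ^ (t - i))) sums (a * ((\<Sum>t. p t) * (\<Sum>t. c ^ t)))"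
    by (rule sums_mult)
  moreover have "(\<Sum>t. p t) = P" "(\<Sum>t. c ^ t) = 1 / (1 - c)"
    using assms by (auto simp: sums_iff suminf_geometric)
  ultimately show ?thesis by (simp add: q[abs_def] mult.commute)
qed

text \<open>Induction on \<open>k\<close>: weighted by powers of \<open>z\<close>, the recurrence
  for the masses multiplies the series by the generating function of one more geometric variable,
  with success probability \<open>a\<close>.\<close>

lemma negocc_mass_pgf_sums:
  assumes "0 < k" "k \<le> m" "0 < \<theta>" "\<theta> \<le> 1" "0 \<le> z"
    and "\<And>i. i < k \<Longrightarrow> (1 - \<theta> * (1 - real i / real m)) * z < 1"
  shows "(\<lambda>t. negocc_mass m k \<theta> t * z ^ t) sums
    (\<Prod>i<k. \<theta> * (1 - real i / real m) / (1 - (1 - \<theta> * (1 - real i / real m)) * z))"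
  using assms(1,2,6)
proof (induction k rule: nat_induct_non_zero)
  case 1
  have "(\<lambda>t. \<theta> * ((1 - \<theta>) * z) ^ t) sums (\<theta> * (1 / (1 - (1 - \<theta>) * z)))"
    using assms 1(2)[of 0] by (intro sums_mult geometric_sums) (auto simp: abs_mult)
  then show ?case
    using 1(1) assms(3) negocc_mass_1[of m \<theta>] by (simp add: power_mult_distrib mult.assoc)
next
  case (Suc k)
  define a where "a = \<theta> * (real m - real k) / real m"
  have km: "0 < k" "k < m" using Suc by auto
  have a: "a = \<theta> * (1 - real k / real m)"
    using km by (simp add: a_def field_simps)
  have "\<theta> * (1 - real k / real m) \<le> 1 * 1"
    using km assms by (intro mult_mono) auto
  then have "a \<le> 1" by (simp add: a)
  have "(\<lambda>t. negocc_mass m (Suc k) \<theta> t * z ^ t) sums (a / (1 - (1 - a) * z) *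
      (\<Prod>i<k. \<theta> * (1 - real i / real m) / (1 - (1 - \<theta> * (1 - real i / real m)) * z)))"
  proof (rule sums_linear_recurrence)
    show "(\<lambda>t. negocc_mass m k \<theta> t * z ^ t) sums
        (\<Prod>i<k. \<theta> * (1 - real i / real m) / (1 - (1 - \<theta> * (1 - real i / real m)) * z))"
      using Suc by simp
    show "negocc_mass m (Suc k) \<theta> 0 * z ^ 0 = a * (negocc_mass m k \<theta> 0 * z ^ 0)"
      using negocc_mass_Suc_0[OF km assms(3)] by (simp add: a_def)
    show "negocc_mass m (Suc k) \<theta> (Suc t) * z ^ Suc t = a * (negocc_mass m k \<theta> (Suc t) * z ^ Suc t)
        + (1 - a) * z * (negocc_mass m (Suc k) \<theta> t * z ^ t)" for t
      unfolding negocc_mass_Suc_Suc[OF km assms(3), folded a_def] by (simp add: algebra_simps)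
    show "0 \<le> negocc_mass m k \<theta> t * z ^ t" for t
      using negocc_mass_nonneg[of k m \<theta> t] assms km by simp
    show "0 \<le> (1 - a) * z" "(1 - a) * z < 1"
      using \<open>a \<le> 1\<close> assms(5) Suc.prems(2)[of k] by (auto simp: a)
  qed
  then show ?case by (simp add: a mult.commute)
qed

text \<open>Nonnegativity turns convergence of the series into integrability, so the Bochner
  integral is the true sum and not its default value 0.\<close>

lemma expectation_pmf_nat_eqI:
  fixes f :: "nat \<Rightarrow> real"
  assumes "(\<lambda>t. pmf p t * f t) sums S" "\<And>t. f t \<ge> 0"
  shows "measure_pmf.expectation p f = S"
proof -
  have "integrable (count_space UNIV) (\<lambda>t. pmf p t * f t)"
    using assms by (auto simp: integrable_count_space_nat_iff sums_iff)
  then have "(\<lambda>t. pmf p t * f t) sums (LINT t|count_space UNIV. pmf p t * f t)"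
    by (rule sums_integral_count_space_nat)
  moreover have "measure_pmf.expectation p f = (LINT t|count_space UNIV. pmf p t * f t)"
    unfolding measure_pmf_eq_density by (subst integral_density) auto
  ultimately show ?thesis using assms(1) by (simp add: sums_iff)
qed

text \<open>Under \<open>dom\<close> the generating function converges at \<open>exp s\<close> and
  all its factors have positive numerator and denominator, so the logarithm of the product
  splits.\<close>

lemma negocc_cgf_eq_sum:
  assumes "0 < k" "k \<le> m" "0 < \<theta>" "\<theta> \<le> 1"
    and dom: "\<And>i. i < k \<Longrightarrow> (1 - \<theta> * (1 - real i / real m)) * exp s < 1"
  shows "negocc_cgf m k \<theta> s = real k * ln \<theta> + (\<Sum>i<k. ln (1 - real i / real m))
    - (\<Sum>i<k. ln (1 - (1 - \<theta> * (1 - real i / real m)) * exp s))"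
proof -
  have "(\<lambda>t. pmf (negocc_pmf m k \<theta>) t * exp (s * real t)) sums
    (\<Prod>i<k. \<theta> * (1 - real i / real m) / (1 - (1 - \<theta> * (1 - real i / real m)) * exp s))"
    using negocc_mass_pgf_sums[of k m \<theta> "exp s"] assms
    by (simp add: pmf_negocc mult.commute[of s] exp_of_nat_mult)
  then have "negocc_cgf m k \<theta> s =
    ln (\<Prod>i<k. \<theta> * (1 - real i / real m) / (1 - (1 - \<theta> * (1 - real i / real m)) * exp s))"
    unfolding negocc_cgf_def by (subst expectation_pmf_nat_eqI) auto
  also have "\<dots> = (\<Sum>i<k. ln (\<theta> * (1 - real i / real m) / (1 - (1 - \<theta> * (1 - real i / real m)) * exp s)))"
  proof (rule ln_prod)
    fix i assume "i \<in> {..<k}"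
    then have "0 < \<theta> * (1 - real i / real m) / (1 - (1 - \<theta> * (1 - real i / real m)) * exp s)"
      using assms(2,3) dom[of i] by (intro divide_pos_pos mult_pos_pos) auto
    then show "\<theta> * (1 - real i / real m) / (1 - (1 - \<theta> * (1 - real i / real m)) * exp s) \<noteq> 0"
      by (metis less_irrefl)
  qed simp
  also have "\<dots> = (\<Sum>i<k. ln \<theta> + ln (1 - real i / real m)
      - ln (1 - (1 - \<theta> * (1 - real i / real m)) * exp s))"
  proof (rule sum.cong)
    fix i assume "i \<in> {..<k}"
    then have "1 - real i / real m > 0" "1 - (1 - \<theta> * (1 - real i / real m)) * exp s > 0"
      using assms by auto
    then show "ln (\<theta> * (1 - real i / real m) / (1 - (1 - \<theta> * (1 - real i / real m)) * exp s))
      = ln \<theta> + ln (1 - real i / real m) - ln (1 - (1 - \<theta> * (1 - real i / real m)) * exp s)"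
      using assms(3) by (subst ln_div) (auto simp: ln_mult)
  qed simp
  finally show ?thesis
    by (simp add: sum.distrib sum_subtractf)
qed

section \<open>Riemann sums of antimonotone functions\<close>

text \<open>By the mean value theorem the increment of \<open>F\<close> is
  \<open>f \<xi> * (y - x)\<close> with \<open>\<xi>\<close> between \<open>x\<close> and
  \<open>y\<close>. The end point \<open>b\<close> is excluded from the antimonotonicity of
  \<open>f\<close>, since \<open>ln (1 - x)\<close> is singular at 1 and has the default value 0
  there.\<close>

lemma antimono_antiderivative_bounds:
  fixes f F :: "real \<Rightarrow> real"
  assumes "x < y" "{x..y} \<subseteq> {0..b}" "continuous_on {0..b} F"
    and "\<And>t. 0 < t \<Longrightarrow> t < b \<Longrightarrow> (F has_real_derivative f t) (at t)"
    and "antimono_on {0..<b} f"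
  shows "F y - F x \<le> f x * (y - x)" and "y < b \<Longrightarrow> f y * (y - x) \<le> F y - F x"
proof -
  have xy: "0 \<le> x" "y \<le> b" using assms(1,2) by auto
  have "continuous_on {x..y} F" using assms(2,3) continuous_on_subset by blast
  moreover have "(F has_derivative (*) (f t)) (at t)" if "x < t" "t < y" for t
    using assms(4)[of t] that xy by (simp add: has_field_derivative_def)
  ultimately obtain \<xi> where \<xi>: "x < \<xi>" "\<xi> < y" "F y - F x = f \<xi> * (y - x)"
    using mvt[OF assms(1), of F "\<lambda>t. (*) (f t)"] by metis
  have "f \<xi> \<le> f x" using \<xi> xy by (intro monotone_onD[OF assms(5)]) auto
  then show "F y - F x \<le> f x * (y - x)" using \<xi> assms(1) by (simp add: mult_right_mono)
  assume "y < b"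
  then have "f y \<le> f \<xi>" using \<xi> xy by (intro monotone_onD[OF assms(5)]) auto
  then show "f y * (y - x) \<le> F y - F x" using \<xi> assms(1) by (simp add: mult_right_mono)
qed

text \<open>Comparing \<open>f\<close> at the left and right ends of each cell with the increment of
  \<open>F\<close> gives telescoping bounds. In the upper bound each term is paired with the cell on
  its left. The term at 0 has no such cell and remains as \<open>f 0\<close>, which leaves only
  \<open>k - 1\<close> cells.\<close>

lemma antimono_riemann_sum_bounds:
  fixes f F :: "real \<Rightarrow> real" and m k :: nat
  assumes F: "continuous_on {0..b} F"
      "\<And>t. 0 < t \<Longrightarrow> t < b \<Longrightarrow> (F has_real_derivative f t) (at t)"
    and f: "antimono_on {0..<b} f"
    and mk: "0 < k" "0 < m" "real k / real m \<le> b"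
  shows "real m * (F (real k / real m) - F 0) \<le> (\<Sum>i<k. f (real i / real m))"
    and "(\<Sum>i<k. f (real i / real m)) \<le> f 0 + real m * (F (real (k - 1) / real m) - F 0)"
proof -
  define r where "r i = real i / real m" for i
  have r: "r i < r (Suc i)" "r (Suc i) - r i = 1 / real m" "0 \<le> r i" for i
    using mk(2) by (auto simp: r_def field_simps)
  have rb: "r (Suc i) \<le> b" if "i < k" for i
    using mk that by (auto simp: r_def field_simps intro: order.trans[rotated])
  have step: "real m * (F (r (Suc i)) - F (r i)) \<le> f (r i)" if "i < k" for i
    using antimono_antiderivative_bounds(1)[OF r(1)[of i] _ F f] rb[OF that] r(2,3)[of i] mk(2)
    by (auto simp: field_simps)
  \<comment> \<open>The right end \<open>r (Suc i)\<close> must lie strictly below \<open>b\<close>;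
    it does because one more grid point, \<open>r (Suc (Suc i))\<close>, is still at most
    \<open>b\<close>.\<close>
  have step': "f (r (Suc i)) \<le> real m * (F (r (Suc i)) - F (r i))" if "Suc i < k" for i
    using antimono_antiderivative_bounds(2)[OF r(1)[of i] _ F f] rb[of i] rb[OF that] r[of i]
      r(1)[of "Suc i"] mk(2) that
    by (auto simp: field_simps)
  have tele: "(\<Sum>i<n. real m * (F (r (Suc i)) - F (r i))) = real m * (F (r n) - F 0)" for n
    unfolding sum_distrib_left[symmetric] sum_lessThan_telescope[of "\<lambda>i. F (r i)"]
    by (simp add: r_def)
  show "real m * (F (real k / real m) - F 0) \<le> (\<Sum>i<k. f (real i / real m))"
    unfolding r_def[symmetric] tele[symmetric] by (intro sum_mono step) auto
  obtain j where j: "k = Suc j" using mk(1) by (cases k) auto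
  have "(\<Sum>i<k. f (r i)) = f 0 + (\<Sum>i<j. f (r (Suc i)))"
    unfolding j sum.lessThan_Suc_shift by (simp add: r_def)
  also have "\<dots> \<le> f 0 + real m * (F (r j) - F 0)"
    unfolding tele[symmetric] by (intro add_left_mono sum_mono step') (auto simp: j)
  finally show "(\<Sum>i<k. f (real i / real m)) \<le> f 0 + real m * (F (real (k - 1) / real m) - F 0)"
    by (simp add: r_def j)
qed

text \<open>Both bounds, divided by \<open>m\<close>, converge to the same value: \<open>F\<close>
  is continuous on the closed interval, \<open>(k - 1) / m\<close> has the same limit as
  \<open>k / m\<close>, and \<open>f 0 / m\<close> vanishes. Only \<open>F\<close>, not
  \<open>f\<close>, has to behave well at \<open>b\<close>.\<close>

lemma antimono_riemann_sum_tendsto: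
  fixes f F :: "real \<Rightarrow> real" and m k :: "nat \<Rightarrow> nat"
  assumes F: "continuous_on {0..b} F"
      "\<And>t. 0 < t \<Longrightarrow> t < b \<Longrightarrow> (F has_real_derivative f t) (at t)"
    and f: "antimono_on {0..<b} f"
    and k: "\<And>n. 0 < k n" and m: "filterlim m at_top sequentially"
    and lim: "(\<lambda>n. real (k n) / real (m n)) \<longlonglongrightarrow> l"
    and le: "\<forall>\<^sub>F n in sequentially. real (k n) / real (m n) \<le> b" and l: "0 \<le> l" "l \<le> b"
  shows "(\<lambda>n. (\<Sum>i<k n. f (real i / real (m n))) / real (m n)) \<longlonglongrightarrow> F l - F 0"
proof -
  have m0: "\<forall>\<^sub>F n in sequentially. 0 < m n"
    using filterlim_at_top[THEN iffD1, OF m, rule_format, of 1] by eventually_elim simp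
  have inv: "(\<lambda>n. c / real (m n)) \<longlonglongrightarrow> 0" for c
    by (rule real_tendsto_divide_at_top[OF tendsto_const
          filterlim_compose[OF filterlim_real_sequentially m]])
  have "(\<lambda>n. real (k n) / real (m n) - 1 / real (m n)) \<longlonglongrightarrow> l - 0"
    using lim inv by (intro tendsto_diff)
  moreover have "real (k n) / real (m n) - 1 / real (m n) = real (k n - 1) / real (m n)" for n
    using k[of n] by (simp add: of_nat_diff diff_divide_distrib Suc_leI)
  ultimately have lim': "(\<lambda>n. real (k n - 1) / real (m n)) \<longlonglongrightarrow> l" by simp
  have Flim: "(\<lambda>n. F (x n)) \<longlonglongrightarrow> F l"
    if "x \<longlonglongrightarrow> l" "\<forall>\<^sub>F n in sequentially. x n \<in> {0..b}" for x :: "nat \<Rightarrow> real"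
    using continuous_on_tendsto_compose[OF F(1) that(1) _ that(2)] l by simp
  have lower_lim: "(\<lambda>n. F (real (k n) / real (m n)) - F 0) \<longlonglongrightarrow> F l - F 0"
    using le by (intro tendsto_diff Flim lim tendsto_const) (auto elim: eventually_mono)
  have "\<forall>\<^sub>F n in sequentially. real (k n - 1) / real (m n) \<in> {0..b}"
    using le
  proof eventually_elim
    case (elim n)
    have "real (k n - 1) / real (m n) \<le> real (k n) / real (m n)"
      by (intro divide_right_mono) auto
    with elim show ?case by auto
  qed
  then have upper_lim: "(\<lambda>n. f 0 / real (m n) + (F (real (k n - 1) / real (m n)) - F 0)) \<longlonglongrightarrow> F l - F 0"
    using tendsto_add[OF inv[of "f 0"] tendsto_diff[OF Flim[OF lim'] tendsto_const]] by simp
  have lower: "\<forall>\<^sub>F n in sequentially. F (real (k n) / real (m n)) - F 0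
      \<le> (\<Sum>i<k n. f (real i / real (m n))) / real (m n)"
    using m0 le
  proof eventually_elim
    case (elim n)
    then show ?case
      using antimono_riemann_sum_bounds(1)[OF F f k[of n] elim] by (simp add: field_simps)
  qed
  have upper: "\<forall>\<^sub>F n in sequentially. (\<Sum>i<k n. f (real i / real (m n))) / real (m n)
      \<le> f 0 / real (m n) + (F (real (k n - 1) / real (m n)) - F 0)"
    using m0 le
  proof eventually_elim
    case (elim n)
    then show ?case
      using antimono_riemann_sum_bounds(2)[OF F f k[of n] elim] by (simp add: field_simps)
  qed
  show ?thesis
    by (rule tendsto_sandwich[OF lower upper lower_lim upper_lim])
qed

section \<open>Asymptotics of the cumulant generating function\<close>

text \<open>The value at 0 agrees with the one-sided limit 0. This carries the antiderivative of
  \<open>ln (1 - x)\<close> continuously up to 1, as the case \<open>l = 1\<close> requires.\<close>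

lemma continuous_on_mult_ln: "continuous_on {0..} (\<lambda>x::real. x * ln x)"
  unfolding continuous_on_eq_continuous_within
proof
  fix x :: real assume "x \<in> {0..}"
  show "continuous (at x within {0..}) (\<lambda>x. x * ln x)"
  proof (cases "x = 0")
    case True
    have "((\<lambda>x::real. x * ln x) \<longlongrightarrow> 0) (at_right 0)" by real_asymp
    then show ?thesis
      by (simp add: True continuous_within at_within_Ici_at_right)
  qed (use \<open>x \<in> {0..}\<close> in \<open>auto intro!: continuous_intros\<close>)
qed

theorem theorem5:
  fixes \<theta> l s :: real and m k :: "nat \<Rightarrow> nat"
  assumes "0 < \<theta>" "\<theta> \<le> 1" and "0 < l" "l \<le> 1"
    and "\<And>n. 0 < k n" and "\<And>n. k n \<le> m n"
    and "filterlim m at_top sequentially"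
    and "filterlim k at_top sequentially"
    and "(\<lambda>n. real (k n) / real (m n)) \<longlonglongrightarrow> l"
    and "s < - ln (1 - (1 - l) * \<theta>)"
  shows "((\<lambda>n. negocc_cgf (m n) (k n) \<theta> s) \<sim>[sequentially]
           (\<lambda>n. real (m n) *
              (l * ln \<theta> - (1 - l) * ln \<bar>1 - l\<bar>
               - (1 - (1 - \<theta>) * exp s) / (\<theta> * exp s) * ln \<bar>1 - (1 - \<theta>) * exp s\<bar>
               + (1 - (1 - \<theta>) * exp s - l * \<theta> * exp s) / (\<theta> * exp s)
                   * ln \<bar>1 - (1 - \<theta>) * exp s - l * \<theta> * exp s\<bar>)))
         \<and> (\<theta> = 1 \<longrightarrow>
         (\<lambda>n. negocc_cgf (m n) (k n) 1 s) \<sim>[sequentially]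
           (\<lambda>n. real (m n) *
              (- (1 - l) * ln \<bar>1 - l\<bar>
               + (1 - l * exp s) / exp s * ln \<bar>1 - l * exp s\<bar>)))"
proof -
  define z where "z = exp s"
  \<comment> \<open>With \<open>p = \<theta> * (1 - x)\<close>, this is the denominator
    \<open>1 - (1 - p) * z\<close> of a factor of the generating function, affine in
    \<open>x\<close>.\<close>
  define u where "u x = 1 - (1 - \<theta>) * z - x * \<theta> * z" for x
  \<comment> \<open>\<open>F\<^sub>1\<close> and \<open>F\<^sub>2\<close> are antiderivatives of
    \<open>ln (1 - x)\<close> and \<open>ln (u x)\<close>; \<open>B\<close> is the bracket of the
    claim.\<close>
  define F\<^sub>1 where "F\<^sub>1 x = - ((1 - x) * ln (1 - x)) - x" for x :: real
  define F\<^sub>2 where "F\<^sub>2 x = - (u x * ln (u x)) / (\<theta> * z) - x" for x :: real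
  define B where "B = l * ln \<theta> - (1 - l) * ln \<bar>1 - l\<bar> - u 0 / (\<theta> * z) * ln \<bar>u 0\<bar>
    + u l / (\<theta> * z) * ln \<bar>u l\<bar>"
  note m = assms(7) and lim = assms(9)
  have z: "z > 0" by (simp add: z_def)
  have tz: "\<theta> * z > 0" using z assms by simp
  have u_diff: "u x - u y = (y - x) * (\<theta> * z)" for x y by (simp add: u_def algebra_simps)
  have u_anti: "u y \<le> u x" if "x \<le> y" for x y
  proof -
    have "0 \<le> (y - x) * (\<theta> * z)" using that tz by (intro mult_nonneg_nonneg[of "y - x"]) auto
    then show ?thesis using u_diff[of x y] by linarith
  qed
  have u_eq: "1 - (1 - \<theta> * (1 - x)) * z = u x" for x by (simp add: u_def algebra_simps)
  have "(1 - l) * \<theta> < 1 * 1 \<or> (1 - l) * \<theta> \<le> 0"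
    using assms(1-4) by (intro disjI1 mult_less_le_imp_less) auto
  then have w: "1 - (1 - l) * \<theta> > 0" by auto
  \<comment> \<open>Exponentiated, the bound on \<open>s\<close> becomes
    \<open>u l > 0\<close>.\<close>
  have "z < exp (- ln (1 - (1 - l) * \<theta>))" using assms(10) by (simp add: z_def)
  then have "z < 1 / (1 - (1 - l) * \<theta>)" using w by (simp add: exp_minus inverse_eq_divide)
  then have "(1 - \<theta> * (1 - l)) * z < 1" using w by (simp add: field_simps)
  then have ul: "u l > 0" using u_eq[of l] by simp
  \<comment> \<open>The ratio \<open>k / m\<close> may exceed \<open>l\<close> before the limit, so
    room to the right of \<open>l\<close> is needed. As \<open>u\<close> has slope
    \<open>- (\<theta> * z)\<close>, the chosen shift halves its value.\<close>
  obtain b where b: "l < b" "u b > 0"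
  proof
    show "l < l + u l / 2 / (\<theta> * z)" using ul tz by simp
    have "u l - u (l + u l / 2 / (\<theta> * z)) = u l / 2" unfolding u_diff using tz assms(1) z by simp
    then show "u (l + u l / 2 / (\<theta> * z)) > 0" using ul by linarith
  qed
  have u_pos: "u x > 0" if "x \<le> b" for x using u_anti[OF that] b by linarith
  have F\<^sub>1_deriv: "(F\<^sub>1 has_real_derivative ln (1 - x)) (at x)" if "x < 1" for x
    unfolding F\<^sub>1_def using that by (auto intro!: derivative_eq_intros)
  have F\<^sub>2_deriv: "(F\<^sub>2 has_real_derivative ln (u x)) (at x)" if "x \<le> b" for x
  proof -
    have "(u has_real_derivative - (\<theta> * z)) (at x)"
      unfolding u_def by (auto intro!: derivative_eq_intros)
    then show ?thesis
      unfolding F\<^sub>2_def using u_pos[OF that] assms(1) z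
      by (auto intro!: derivative_eq_intros simp: field_simps)
  qed
  have F\<^sub>1_cont: "continuous_on {0..1} F\<^sub>1"
    unfolding F\<^sub>1_def by (intro continuous_intros continuous_on_compose2[OF continuous_on_mult_ln]) auto
  have F\<^sub>2_cont: "continuous_on {0..b} F\<^sub>2"
    using F\<^sub>2_deriv by (meson DERIV_isCont atLeastAtMost_iff continuous_at_imp_continuous_on)
  have B_eq: "B = l * ln \<theta> + (F\<^sub>1 l - F\<^sub>1 0) - (F\<^sub>2 l - F\<^sub>2 0)"
    using ul u_pos[of 0] b assms(3,4) by (simp add: B_def F\<^sub>1_def F\<^sub>2_def)
  have le1: "real (k n) / real (m n) \<le> 1" for n
    using assms(5,6)[of n] by (simp add: divide_le_eq)
  have leb: "\<forall>\<^sub>F n in sequentially. real (k n) / real (m n) < b"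
    using order_tendstoD(2)[OF lim b(1)] .
  \<comment> \<open>Here the right end is 1, where the integrand is singular if reached by
    \<open>l\<close>; in \<open>lim2\<close> it is \<open>b\<close>, up to which \<open>u\<close>
    stays positive.\<close>
  have lim1: "(\<lambda>n. (\<Sum>i<k n. ln (1 - real i / real (m n))) / real (m n)) \<longlonglongrightarrow> F\<^sub>1 l - F\<^sub>1 0"
    using assms(3,4) le1 F\<^sub>1_deriv
    by (intro antimono_riemann_sum_tendsto[OF F\<^sub>1_cont _ _ assms(5) m lim]) (auto intro!: monotone_onI)
  have lim2: "(\<lambda>n. (\<Sum>i<k n. ln (u (real i / real (m n)))) / real (m n)) \<longlonglongrightarrow> F\<^sub>2 l - F\<^sub>2 0"
    using assms(3) b(1) F\<^sub>2_deriv leb u_pos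
    by (intro antimono_riemann_sum_tendsto[OF F\<^sub>2_cont _ _ assms(5) m lim])
      (auto intro!: monotone_onI u_anti elim: eventually_mono)
  \<comment> \<open>The formula is available only eventually: once \<open>k / m < b\<close>, every
    factor has a positive denominator.\<close>
  have cgf: "\<forall>\<^sub>F n in sequentially. real (k n) / real (m n) * ln \<theta>
      + (\<Sum>i<k n. ln (1 - real i / real (m n))) / real (m n)
      - (\<Sum>i<k n. ln (u (real i / real (m n)))) / real (m n)
      = negocc_cgf (m n) (k n) \<theta> s / real (m n)"
    using leb
  proof eventually_elim
    case (elim n)
    have dom: "(1 - \<theta> * (1 - real i / real (m n))) * exp s < 1" if "i < k n" for i
    proof -
      have "real i / real (m n) \<le> real (k n) / real (m n)"
        using that by (intro divide_right_mono) auto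
      then show ?thesis using elim u_pos[of "real i / real (m n)"] u_eq[of "real i / real (m n)"]
        by (simp add: z_def)
    qed
    show ?case
      using negocc_cgf_eq_sum[OF assms(5,6,1,2) dom]
      by (simp add: u_eq[unfolded z_def] add_divide_distrib diff_divide_distrib)
  qed
  have "(\<lambda>n. real (k n) / real (m n) * ln \<theta>
      + (\<Sum>i<k n. ln (1 - real i / real (m n))) / real (m n)
      - (\<Sum>i<k n. ln (u (real i / real (m n)))) / real (m n)) \<longlonglongrightarrow> B"
    unfolding B_eq by (intro tendsto_intros lim lim1 lim2)
  then have K: "(\<lambda>n. negocc_cgf (m n) (k n) \<theta> s / real (m n)) \<longlonglongrightarrow> B"
    using cgf by (rule Lim_transform_eventually)
  have main: "(\<lambda>n. negocc_cgf (m n) (k n) \<theta> s) \<sim>[sequentially] (\<lambda>n. real (m n) * B)"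
  \<comment> \<open>If \<open>s = 0\<close>, then \<open>B = 0\<close>, and equivalence to zero
    holds because the cumulant generating function is exactly \<open>ln 1 = 0\<close>.\<close>
  proof (cases "s = 0")
    case True
    then have u: "u 0 = \<theta>" "u l = \<theta> * (1 - l)" by (auto simp: u_def z_def algebra_simps)
    \<comment> \<open>At \<open>s = 0\<close> the domain condition rules out \<open>l = 1\<close>,
      so the logarithm of the product can be split.\<close>
    then have "1 - l > 0" using ul assms(1) by (simp add: zero_less_mult_iff)
    then have "ln (\<theta> * (1 - l)) = ln \<theta> + ln (1 - l)" "\<bar>\<theta> * (1 - l)\<bar> = \<theta> * (1 - l)"
      using assms(1) by (simp_all add: ln_mult)
    then have "B = 0"
      using True assms(1) \<open>1 - l > 0\<close> unfolding B_def u by (simp add: z_def left_diff_distrib distrib_left)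
    then show ?thesis by (simp add: True negocc_cgf_def)
  next
    case False
    \<comment> \<open>\<open>B\<close> is the increment of \<open>H\<close> over
      \<open>{0..l}\<close>, so the mean value theorem writes it as \<open>l\<close> times the
      integrand at an interior point \<open>\<xi>\<close>.\<close>
    define H where "H x = x * ln \<theta> + F\<^sub>1 x - F\<^sub>2 x" for x
    have H_cont: "continuous_on {0..l} H"
      unfolding H_def using assms(4) b(1)
      by (intro continuous_intros continuous_on_subset[OF F\<^sub>1_cont] continuous_on_subset[OF F\<^sub>2_cont]) auto
    have H_deriv: "(H has_derivative (*) (ln \<theta> + ln (1 - x) - ln (u x))) (at x)"
      if "0 < x" "x < l" for x
      using that assms(4) b(1) unfolding H_def has_field_derivative_def[symmetric]
      by (auto intro!: derivative_eq_intros F\<^sub>1_deriv F\<^sub>2_deriv)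
    obtain \<xi> where \<xi>: "0 < \<xi>" "\<xi> < l"
      "H l - H 0 = (ln \<theta> + ln (1 - \<xi>) - ln (u \<xi>)) * (l - 0)"
      by (rule mvt[OF assms(3) H_cont H_deriv])
    have "\<theta> * (1 - \<xi>) < 1"
      using mult_le_less_imp_less[of \<theta> 1 "1 - \<xi>" 1] \<xi> assms(1-4) by simp
    \<comment> \<open>The integrand vanishes only where
      \<open>\<theta> * (1 - \<xi>) = u \<xi>\<close>. This factorization excludes that: the first
      factor is positive at an interior point, and \<open>z = 1\<close> only for
      \<open>s = 0\<close>.\<close>
    moreover have "\<theta> * (1 - \<xi>) - u \<xi> = (1 - \<theta> * (1 - \<xi>)) * (z - 1)"
      by (simp add: u_def algebra_simps)
    ultimately have "\<theta> * (1 - \<xi>) \<noteq> u \<xi>" using False by (auto simp: z_def)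
    moreover have "0 < \<theta> * (1 - \<xi>)" "0 < u \<xi>" using \<xi> assms(1,4) u_pos[of \<xi>] b by auto
    ultimately have "ln (\<theta> * (1 - \<xi>)) \<noteq> ln (u \<xi>)" by simp
    then have "ln \<theta> + ln (1 - \<xi>) - ln (u \<xi>) \<noteq> 0" using \<xi> assms(1,4) by (simp add: ln_mult)
    moreover have "B = H l - H 0" by (simp add: B_eq H_def)
    ultimately have "B \<noteq> 0" using \<xi>(3) assms(3) by simp
    have "(\<lambda>n. negocc_cgf (m n) (k n) \<theta> s / (real (m n) * B)) \<longlonglongrightarrow> 1"
      using tendsto_divide[OF K tendsto_const \<open>B \<noteq> 0\<close>] \<open>B \<noteq> 0\<close> by simp
    then show ?thesis by (rule asymp_equivI')
  qed
  \<comment> \<open>For \<open>\<theta> = 1\<close> both \<open>ln \<theta>\<close> and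
    \<open>ln \<bar>u 0\<bar>\<close> are \<open>ln 1 = 0\<close>.\<close>
  have B_1: "- (1 - l) * ln \<bar>1 - l\<bar> + (1 - l * exp s) / exp s * ln \<bar>1 - l * exp s\<bar> = B"
    if "\<theta> = 1"
    using that by (simp add: B_def u_def z_def algebra_simps)
  show ?thesis
  proof (intro conjI impI)
    assume "\<theta> = 1"
    with main show "(\<lambda>n. negocc_cgf (m n) (k n) 1 s) \<sim>[sequentially]
        (\<lambda>n. real (m n) * (- (1 - l) * ln \<bar>1 - l\<bar> + (1 - l * exp s) / exp s * ln \<bar>1 - l * exp s\<bar>))"
      unfolding B_1[OF \<open>\<theta> = 1\<close>] by simp
  qed (use main in \<open>simp add: B_def u_def z_def\<close>)
qed

end
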